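(* Let $p\in(1,2)$. There exists a universal constant $C>0$ such that $$\|f\circ\psi\|_{\mathrm{LBMO}\cap L^p}\le C\ln(1+\|\psi\|_* )\,\|f\|_{\mathrm{LBMO}\cap L^p}$$ for every $f\in \mathrm{LBMO}\cap L^p(\mathbb R^2)$ and every Lebesgue measure preserving homeomorphism $\psi$ of $\mathbb R^2$.
   Context: For a set $D\subset\mathbb R^2$ of positive finite measure, $\mathrm{Avg}_D(g)=\frac1{|D|}\int_D g(x)\,dx$. For a ball $B$ and $\lambda>0$, $\lambda B$ is the concentric ball with radius $\lambda$ times that of $B$. $\|f\|_{\mathrm{BMO}}=\sup_{B\text{ ball}}\mathrm{Avg}_B|f-\mathrm{Avg}_B(f)|$ for locally integrable complex-valued $f$ on $\mathbb R^2$. $\mathrm{LBMO}$ is the space of locally integrable complex-valued functions on $\mathbb R^2$ with finite $$\|f\|_{\mathrm{LBMO}}:=\|f\|_{\mathrm{BMO}}+\sup_{B_1,B_2}\frac{|\mathrm{Avg}_{B_2}(f)-\mathrm{Avg}_{B_1}(f)|}{1+\ln\big(\frac{1-\ln r_2}{1-\ln r_1}\big)},$$ where the supremum is over all pairs of balls $B_2=B(x_2,r_2)$, $B_1=B(x_1,r_1)$ in $\mathbb R^2$ with $0<r_1\le1$ and $2B_2\subset B_1$. The norm on $\mathrm{LBMO}\cap L^p$ is $\|f\|_{\mathrm{LBMO}\cap L^p}=\|f\|_{L^p}+\|f\|_{\mathrm{LBMO}}$. For a homeomorphism $\psi$ of $\mathbb R^2$, $$\|\psi\|_*:=\sup_{x\ne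 y}\Phi\big(|\psi(x)-\psi(y)|,|x-y|\big)\in[1,\infty],$$ where for $r,s>0$ $$\Phi(r,s)=\begin{cases}\max\Big\{\dfrac{1+|\ln s|}{1+|\ln r|},\dfrac{1+|\ln r|}{1+|\ln s|}\Big\} & \text{if }(1-s)(1-r)\ge0,\\[2mm](1+|\ln s|)(1+|\ln r|)&\text{if }(1-s)(1-r)\le0\end{cases}$$ (the two expressions agree when $(1-s)(1-r)=0$). If $\|\psi\|_*=\infty$ the right-hand side of the inequality is understood as $+\infty$, so the inequality is empty. *)

theory Defs
  imports "HOL-Analysis.Analysis"
begin

definition locally_integrable :: "(real^2 \<Rightarrow> complex) \<Rightarrow> bool" where
  "locally_integrable f \<longleftrightarrow> (\<forall>K. compact K \<longrightarrow> f absolutely_integrable_on K)"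

definition Avg :: "(real^2) set \<Rightarrow> (real^2 \<Rightarrow> 'a) \<Rightarrow> 'a::euclidean_space" where
  "Avg D g = (1 / measure lebesgue D) *\<^sub>R (LINT x:D|lebesgue. g x)"

text \<open>The suprema below may be infinite, so they are taken in \<^typ>\<open>ennreal\<close>; all quantities
  under them are nonnegative, so \<^const>\<open>ennreal\<close> truncates nothing.\<close>

definition BMO_norm :: "(real^2 \<Rightarrow> complex) \<Rightarrow> ennreal" where
  "BMO_norm f =
     (SUP (x, r) \<in> {(x, r). 0 < r}.
        ennreal (Avg (ball x r) (\<lambda>y. norm (f y - Avg (ball x r) f))))"

text \<open>Here \<^term>\<open>2 * r2 \<le> r1\<close> follows from the inclusion, so the logarithm of the quotient is
  nonnegative.\<close>

definition LBMO_norm :: "(real^2 \<Rightarrow> complex) \<Rightarrow> ennreal" where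
  "LBMO_norm f = BMO_norm f +
     (SUP (x1, r1, x2, r2) \<in> {(x1, r1, x2, r2).
          0 < r1 \<and> r1 \<le> 1 \<and> 0 < r2 \<and> ball x2 (2 * r2) \<subseteq> ball x1 r1}.
        ennreal (norm (Avg (ball x2 r2) f - Avg (ball x1 r1) f)
                 / (1 + ln ((1 - ln r2) / (1 - ln r1)))))"

definition LBMO :: "(real^2 \<Rightarrow> complex) set" where
  "LBMO = {f. locally_integrable f \<and> LBMO_norm f < \<infinity>}"

definition Lp :: "real \<Rightarrow> (real^2 \<Rightarrow> complex) set" where
  "Lp p = {f \<in> borel_measurable lebesgue. integrable lebesgue (\<lambda>x. norm (f x) powr p)}"

definition Lp_norm :: "real \<Rightarrow> (real^2 \<Rightarrow> complex) \<Rightarrow> real" where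
  "Lp_norm p f = (LINT x|lebesgue. norm (f x) powr p) powr (1 / p)"

definition LBMO_Lp_norm :: "real \<Rightarrow> (real^2 \<Rightarrow> complex) \<Rightarrow> ennreal" where
  "LBMO_Lp_norm p f = ennreal (Lp_norm p f) + LBMO_norm f"

definition Phi :: "real \<Rightarrow> real \<Rightarrow> real" where
  "Phi r s =
     (if (1 - s) * (1 - r) \<ge> 0
      then max ((1 + \<bar>ln s\<bar>) / (1 + \<bar>ln r\<bar>)) ((1 + \<bar>ln r\<bar>) / (1 + \<bar>ln s\<bar>))
      else (1 + \<bar>ln s\<bar>) * (1 + \<bar>ln r\<bar>))"

definition star_norm :: "(real^2 \<Rightarrow> real^2) \<Rightarrow> ennreal" where
  "star_norm \<psi> = (SUP (x, y) \<in> {(x, y). x \<noteq> y}. ennreal (Phi (dist (\<psi> x) (\<psi> y)) (dist x y)))"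

definition measure_preserving_homeomorphism :: "(real^2 \<Rightarrow> real^2) \<Rightarrow> bool" where
  "measure_preserving_homeomorphism \<psi> \<longleftrightarrow>
     (\<exists>\<phi>. homeomorphism UNIV UNIV \<psi> \<phi>) \<and>
     \<psi> \<in> lebesgue \<rightarrow>\<^sub>M lebesgue \<and> distr lebesgue lebesgue \<psi> = lebesgue"

end

theory Submission
  imports Defs
begin

text \<open>Put \<open>llog s = ln (1 + max 0 (- ln s))\<close>. Then \<open>Phi r s \<le> K\<close> gives \<open>\<bar>llog r - llog s\<bar> \<le> ln K\<close>, so
  a homeomorphism with \<open>star_norm \<psi> \<le> K\<close> distorts the \<open>llog\<close>-size of distances by at most \<open>\<kappa> = ln K\<close>, while the
  LBMO denominators are \<open>1 + llog r2 - llog r1\<close>.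

  For a ball \<open>B\<close> with image \<open>U = \<psi> ` B\<close> and \<open>d z = infdist z (- U)\<close>, Tonelli's theorem bounds
  the integral of \<open>\<bar>f - c\<bar>\<close> over \<open>U\<close> by \<open>9/4\<close> times that of its averages over the balls \<open>ball z (d z / 4)\<close>
  (a continuous substitute for a Whitney covering of \<open>U\<close>). Those averages are controlled by \<open>llog (d z)\<close>, and
  for \<open>z = \<psi> x\<close> the point \<open>x\<close> has distance at least \<open>r - dist x x0\<close> to the complement of \<open>B = ball x0 r\<close>, so
  \<open>llog (d (\<psi> x)) \<le> \<kappa> + llog r + ln (r / (r - dist x x0))\<close>, where the last term has bounded average
  over \<open>B\<close>.\<close>

section \<open>The doubly logarithmic scale\<close>

definition llog :: "real \<Rightarrow> real" where
  "llog s = ln (1 + max 0 (- ln s))"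

lemma llog_nonneg: "0 \<le> llog s"
  by (simp add: llog_def)

lemma llog_eq_0: "1 \<le> s \<Longrightarrow> llog s = 0"
  by (simp add: llog_def max_def)

lemma llog_antimono: "0 < s \<Longrightarrow> s \<le> t \<Longrightarrow> llog t \<le> llog s"
proof -
  assume "0 < s" "s \<le> t"
  then have "max 0 (- ln t) \<le> max 0 (- ln s)" using ln_mono[of s t] by linarith
  then show ?thesis by (simp add: llog_def add_pos_nonneg)
qed

text \<open>Shrinking a radius by a factor costs at most the logarithm of that factor. With
  \<open>v = max 0 (- ln r)\<close> and \<open>u = ln (r / t)\<close> this is
  \<open>1 + v + u \<le> (1 + v) * (1 + u)\<close> followed by
  \<open>ln (1 + u) \<le> u\<close>.\<close>

lemma llog_le_add_ln:
  assumes "0 < t" "t \<le> r"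
  shows "llog t \<le> llog r + ln (r / t)"
proof -
  define u where "u = ln (r / t)"
  define v where "v = max 0 (- ln r)"
  have u: "u \<ge> 0" "u = ln r - ln t"
    using assms by (simp_all add: u_def ln_div)
  have v: "v \<ge> 0" by (simp add: v_def)
  have "1 + max 0 (- ln t) \<le> 1 + (v + u)"
    using u by (simp add: v_def)
  also have "\<dots> \<le> (1 + v) * (1 + u)"
    using u v by (simp add: algebra_simps)
  finally have "llog t \<le> ln ((1 + v) * (1 + u))"
    by (simp add: llog_def)
  also have "\<dots> = llog r + ln (1 + u)"
    using u v by (simp add: ln_mult llog_def v_def)
  also have "ln (1 + u) \<le> u"
    using u by (simp add: ln_add_one_self_le_self)
  finally show ?thesis by (simp add: u_def)
qed

text \<open>Since \<open>llog\<close> is constant on \<open>s \<ge> 1\<close>, its monotonicity can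
  be inverted only below 1; positivity of \<open>llog R\<close> says exactly that
  \<open>R < 1\<close>.\<close>

lemma le_of_llog_le:
  assumes "0 < s" "0 < R" "0 < llog R" "llog R \<le> llog s"
  shows "s \<le> R"
proof -
  have "max 0 (- ln R) \<le> max 0 (- ln s)" "0 < max 0 (- ln R)"
    using assms by (auto simp: llog_def add_pos_nonneg)
  then show ?thesis using assms by (auto simp: max_def split: if_splits)
qed

lemma ln_two_power_le: "ln (2 ^ k) \<le> real k"
proof -
  have "ln 2 \<le> (1::real)" using ln_le_minus_one[of 2] by simp
  then have "real k * ln 2 \<le> real k * 1" by (intro mult_left_mono) auto
  then show ?thesis by (simp add: ln_realpow)
qed

lemma llog_scale: "0 < s \<Longrightarrow> llog s \<le> llog (2 ^ k * s) + real k"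
  using llog_le_add_ln[of s "2 ^ k * s"] ln_two_power_le[of k] by simp

text \<open>For \<open>s \<le> 1\<close> one has \<open>1 - ln s = exp (llog s)\<close>, so the
  logarithm in the LBMO denominator becomes a difference of \<open>llog\<close> values.\<close>

lemma llog_diff:
  assumes "0 < r2" "r2 \<le> r1" "r1 \<le> 1"
  shows "ln ((1 - ln r2) / (1 - ln r1)) = llog r2 - llog r1"
proof -
  have "ln r1 \<le> 0" "ln r2 \<le> 0" using assms by auto
  then show ?thesis by (simp add: llog_def ln_div)
qed

section \<open>Distortion of \<open>llog\<close> under a bound on \<open>Phi\<close>\<close>

lemma Phi_ge_1: "1 \<le> Phi r s"
proof -
  have "1 \<le> max (a / b) (b / a)" if "a \<ge> 1" "b \<ge> 1" for a b :: real
    using that by (cases "a \<le> b") (auto simp: le_max_iff_disj)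
  moreover have "1 \<le> a * b" if "a \<ge> 1" "b \<ge> 1" for a b :: real
    using mult_mono[of 1 a 1 b] that by simp
  ultimately show ?thesis by (simp add: Phi_def)
qed

lemma Phi_commute: "Phi r s = Phi s r"
  by (simp add: Phi_def mult.commute max.commute)

text \<open>Only \<open>r < 1\<close> needs an argument. If \<open>s \<le> 1\<close>, the first
  branch of \<open>Phi\<close> bounds the quotient of \<open>1 - ln r\<close> and
  \<open>1 - ln s\<close>. If \<open>s > 1\<close>, the second branch applies and dropping its
  factor \<open>1 + \<bar>ln s\<bar> \<ge> 1\<close> leaves \<open>1 - ln r \<le> K\<close>. The
  reverse estimate follows from \<open>Phi_commute\<close>.\<close>

lemma llog_le_of_Phi_le:
  assumes K: "Phi r s \<le> K" and "0 < r" "0 < s"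
  shows "llog r \<le> llog s + ln K"
proof -
  have K1: "1 \<le> K" using K Phi_ge_1[of r s] by linarith
  show ?thesis
  proof (cases "r \<ge> 1")
    case True
    then show ?thesis using llog_nonneg[of s] K1 by (simp add: llog_eq_0)
  next
    case False
    then have r: "ln r < 0" "r < 1" using \<open>0 < r\<close> by auto
    show ?thesis
    proof (cases "s \<le> 1")
      case True
      then have s: "ln s \<le> 0" using \<open>0 < s\<close> by auto
      have "(1 - ln r) / (1 - ln s) \<le> K"
        using K True r s by (auto simp: Phi_def)
      then have "ln ((1 - ln r) / (1 - ln s)) \<le> ln K"
        using r s K1 by (intro ln_mono) auto
      then show ?thesis using r s by (simp add: llog_def ln_div)
    next
      case s: False
      have "(1 - s) * (1 - r) < 0"
        using r s by (intro mult_neg_pos) auto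
      then have "(1 + \<bar>ln s\<bar>) * (1 - ln r) \<le> K"
        using K r by (simp add: Phi_def)
      moreover have "1 * (1 - ln r) \<le> (1 + \<bar>ln s\<bar>) * (1 - ln r)"
        using r by (intro mult_right_mono) auto
      ultimately have "1 - ln r \<le> K"
        by (metis mult_1 order_trans)
      then have "ln (1 - ln r) \<le> ln K"
        using r by (intro ln_mono) linarith+
      then show ?thesis using s r by (simp add: llog_eq_0) (simp add: llog_def)
    qed
  qed
qed

section \<open>Integrals over open sets and balls of the plane\<close>

lemma emeasure_ball_plane:
  "r \<ge> 0 \<Longrightarrow> emeasure lborel (ball (c :: real^2) r) = ennreal (pi * r\<^sup>2)"
  by (simp add: emeasure_ball unit_ball_vol_2)

lemma measure_ball_plane:
  "r \<ge> 0 \<Longrightarrow> measure lborel (ball (c :: real^2) r) = pi * r\<^sup>2"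
  by (simp add: content_ball unit_ball_vol_2)

lemma sigma_finite_lebesgue: "sigma_finite_measure (lebesgue :: 'a::euclidean_space measure)"
proof -
  obtain A :: "'a set set" where "countable A" "A \<subseteq> sets lborel" "\<Union>A = space lborel"
      "\<forall>a\<in>A. emeasure lborel a \<noteq> \<infinity>"
    using lborel.sigma_finite_countable by blast
  then show ?thesis
    by (intro sigma_finite_measure.intro exI[of _ A]) auto
qed

text \<open>The averages over the balls \<open>ball z (infdist z (-U) / 4)\<close> control \<open>g\<close> since each \<open>y\<close> lies in
  such a ball for all \<open>z\<close> with \<open>dist y z < infdist y (-U) / 5\<close>.\<close>

lemma set_nn_integral_le_averages:
  fixes g :: "real^2 \<Rightarrow> ennreal"
  assumes [measurable]: "g \<in> borel_measurable lebesgue" and U: "open U" "U \<noteq> UNIV"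
  defines "d \<equiv> \<lambda>z. infdist z (- U)"
  shows "(\<integral>\<^sup>+y\<in>U. g y \<partial>lebesgue) \<le>
    ennreal (9 / 4) * (\<integral>\<^sup>+z\<in>U. ((\<integral>\<^sup>+y\<in>ball z (d z / 4). g y \<partial>lebesgue)
                                * ennreal (1 / (pi * (d z / 4)\<^sup>2))) \<partial>lebesgue)"
proof -
  interpret L: sigma_finite_measure "lebesgue :: (real^2) measure" by (rule sigma_finite_lebesgue)
  interpret P: pair_sigma_finite "lebesgue :: (real^2) measure" "lebesgue :: (real^2) measure" ..
  have [measurable]: "U \<in> sets lebesgue" using U by simp
  have [measurable]: "U \<in> sets borel" using U by simp
  have dcont: "continuous_on UNIV d" unfolding d_def by (intro continuous_intros)
  have d0: "d z \<ge> 0" for z by (simp add: d_def infdist_nonneg)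
  have dpos: "d z > 0" if "z \<in> U" for z
    unfolding d_def using U that by (intro infdist_pos_not_in_closed) auto
  have dU: "z \<in> U" if "d z > 0" for z
    using that unfolding d_def by (cases "z \<in> U") auto
  define w where "w = (\<lambda>z. indicator U z * ennreal (1 / (pi * (d z / 4)\<^sup>2)))"
  have d_meas [measurable]: "d \<in> borel_measurable borel"
    using dcont by (rule borel_measurable_continuous_onI)
  have w_meas [measurable]: "w \<in> borel_measurable borel" unfolding w_def by measurable
  have w_leb [measurable]: "w \<in> borel_measurable lebesgue"
    using w_meas by (simp add: measurable_completion)
  define S where "S = {(z, y). dist z y < d z / 4}"
  have S_open: "open S"
    unfolding S_def case_prod_beta
    by (intro open_Collect_less continuous_intros
          continuous_on_compose2[OF dcont]) auto
  \<comment> \<open>Tonelli's theorem is applied to the product of the two completed measures. Borel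
    sets of the product space are measurable there, so openness of \<open>S\<close> gives the joint
    measurability of its indicator.\<close>
  have idm: "(\<lambda>p. p) \<in> (lebesgue \<Otimes>\<^sub>M lebesgue) \<rightarrow>\<^sub>M (borel :: ((real^2) \<times> (real^2)) measure)"
  proof -
    have [measurable]: "fst \<in> (lebesgue \<Otimes>\<^sub>M lebesgue :: ((real^2) \<times> (real^2)) measure) \<rightarrow>\<^sub>M borel"
      "snd \<in> (lebesgue \<Otimes>\<^sub>M lebesgue :: ((real^2) \<times> (real^2)) measure) \<rightarrow>\<^sub>M borel"
      by (rule measurable_compose[OF measurable_fst], simp add: measurable_completion)
         (rule measurable_compose[OF measurable_snd], simp add: measurable_completion)
    have "(\<lambda>p. (fst p, snd p)) \<in> (lebesgue \<Otimes>\<^sub>M lebesgue) \<rightarrow>\<^sub>M (borel :: ((real^2) \<times> (real^2)) measure)"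
      by (intro borel_measurable_Pair) measurable
    then show ?thesis by simp
  qed
  have S_meas [measurable]: "(\<lambda>p. indicator S p :: ennreal) \<in> borel_measurable (lebesgue \<Otimes>\<^sub>M lebesgue)"
    using S_open by (intro measurable_compose[OF idm] borel_measurable_indicator) simp
  have pw: "g y * indicator U y \<le> ennreal (9 / 4) * (\<integral>\<^sup>+z. indicator S (z, y) * w z * g y \<partial>lebesgue)" for y
  proof (cases "y \<in> U")
    case True
    define e where "e = d y"
    have e: "e > 0" using dpos[OF True] by (simp add: e_def)
    \<comment> \<open>For \<open>dist y z < e / 5\<close> the value \<open>d z\<close> lies between
      \<open>4 * e / 5\<close> and \<open>6 * e / 5\<close>. The lower bound puts \<open>y\<close>
      into \<open>ball z (d z / 4)\<close>; the upper one gives \<open>d z / 4 < 3 * e / 10\<close>,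
      so the weight at \<open>z\<close> is at least \<open>c\<close>. Multiplying \<open>c\<close>
      by the area of \<open>ball y (e / 5)\<close> yields 4/9.\<close>
    define c where "c = 1 / (pi * (3 * e / 10)\<^sup>2)"
    have "indicator (ball y (e / 5)) z * ennreal c \<le> indicator S (z, y) * w z" for z
    proof (cases "z \<in> ball y (e / 5)")
      case z: True
      have a: "e \<le> d z + dist y z" "d z \<le> e + dist y z"
        using infdist_triangle[of y "-U" z] infdist_triangle[of z "-U" y]
        by (simp_all add: d_def e_def dist_commute)
      then have b: "d z > 4 * e / 5" "d z < 6 * e / 5" using z by auto
      then have zU: "z \<in> U" using dU[of z] e by auto
      have "pi * (d z / 4)\<^sup>2 \<le> pi * (3 * e / 10)\<^sup>2"
        using b d0[of z] by (intro mult_left_mono power_mono) auto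
      moreover have "pi * (d z / 4)\<^sup>2 > 0" using b e by simp
      ultimately have "c \<le> 1 / (pi * (d z / 4)\<^sup>2)"
        unfolding c_def by (intro divide_left_mono) (use e in auto)
      then show ?thesis
        using z b zU by (auto simp: S_def w_def dist_commute intro: ennreal_leI)
    qed auto
    then have "(\<integral>\<^sup>+z. ennreal c * indicator (ball y (e / 5)) z \<partial>lebesgue) \<le> (\<integral>\<^sup>+z. indicator S (z, y) * w z \<partial>lebesgue)"
      by (intro nn_integral_mono) (simp add: mult.commute)
    also have "(\<integral>\<^sup>+z. ennreal c * indicator (ball y (e / 5)) z \<partial>lebesgue) = ennreal c * ennreal (pi * (e / 5)\<^sup>2)"
      using e by (subst nn_integral_cmult_indicator) (auto simp: emeasure_ball_plane)
    also have "\<dots> = ennreal (4 / 9)"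
      using e by (simp add: c_def ennreal_mult[symmetric] power2_eq_square)
    finally have "ennreal (4/9) * g y \<le> (\<integral>\<^sup>+z. indicator S (z, y) * w z \<partial>lebesgue) * g y"
      by (rule mult_right_mono) simp
    also have "\<dots> = (\<integral>\<^sup>+z. indicator S (z, y) * w z * g y \<partial>lebesgue)"
      by (rule nn_integral_multc[symmetric]) measurable
    finally have "ennreal (9/4) * (ennreal (4/9) * g y) \<le> ennreal (9/4) * (\<integral>\<^sup>+z. indicator S (z, y) * w z * g y \<partial>lebesgue)"
      by (rule mult_left_mono) simp
    moreover have "ennreal (9/4) * ennreal (4/9) = 1" by (simp add: ennreal_mult[symmetric])
    ultimately show ?thesis using True by (simp add: mult.assoc[symmetric])
  qed auto
  have "(\<integral>\<^sup>+y\<in>U. g y \<partial>lebesgue) \<le> (\<integral>\<^sup>+y. ennreal (9 / 4) * (\<integral>\<^sup>+z. indicator S (z, y) * w z * g y \<partial>lebesgue) \<partial>lebesgue)"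
    by (intro nn_integral_mono pw)
  also have "\<dots> = ennreal (9 / 4) * (\<integral>\<^sup>+y. (\<integral>\<^sup>+z. indicator S (z, y) * w z * g y \<partial>lebesgue) \<partial>lebesgue)"
    by (rule nn_integral_cmult) measurable
  also have "(\<integral>\<^sup>+y. (\<integral>\<^sup>+z. indicator S (z, y) * w z * g y \<partial>lebesgue) \<partial>lebesgue)
    = (\<integral>\<^sup>+z. (\<integral>\<^sup>+y. indicator S (z, y) * w z * g y \<partial>lebesgue) \<partial>lebesgue)"
    by (rule P.Fubini') measurable
  also have "\<dots> = (\<integral>\<^sup>+z\<in>U. ((\<integral>\<^sup>+y\<in>ball z (d z / 4). g y \<partial>lebesgue)
                                * ennreal (1 / (pi * (d z / 4)\<^sup>2))) \<partial>lebesgue)"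
  proof (rule nn_integral_cong)
    fix z :: "real^2"
    have [measurable]: "ball z (d z / 4) \<in> sets lebesgue" by simp
    have "(\<integral>\<^sup>+y. indicator S (z, y) * w z * g y \<partial>lebesgue) = (\<integral>\<^sup>+y. w z * (g y * indicator (ball z (d z / 4)) y) \<partial>lebesgue)"
      by (intro nn_integral_cong) (auto simp: S_def indicator_def mult_ac)
    also have "\<dots> = w z * (\<integral>\<^sup>+y\<in>ball z (d z / 4). g y \<partial>lebesgue)"
      by (rule nn_integral_cmult) measurable
    finally show "(\<integral>\<^sup>+y. indicator S (z, y) * w z * g y \<partial>lebesgue) = (\<integral>\<^sup>+y\<in>ball z (d z / 4). g y \<partial>lebesgue)
         * ennreal (1 / (pi * (d z / 4)\<^sup>2)) * indicator U z"
      by (simp add: w_def mult_ac)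
  qed
  finally show ?thesis .
qed

text \<open>The logarithm is dominated by the number of dyadic boundary shells \<open>A k\<close>
  that contain the point. The shells have measure at most
  \<open>2 * (pi * r\<^sup>2) / 2 ^ k\<close>, and the geometric series sums to the bound.\<close>

lemma set_nn_integral_ln_ball:
  fixes x0 :: "real^2"
  assumes r: "0 < r"
  shows "(\<integral>\<^sup>+x\<in>ball x0 r. ennreal (ln (r / (r - dist x x0))) \<partial>lebesgue) \<le> ennreal (4 * (pi * r\<^sup>2))"
proof -
  define A where "A = (\<lambda>k::nat. ball x0 r - ball x0 (r - r / 2 ^ k))"
  have [measurable]: "A k \<in> sets lebesgue" for k by (simp add: A_def)
  have "ennreal (ln (r / (r - dist x x0))) * indicator (ball x0 r) x \<le> (\<Sum>k. indicator (A k) x)" for x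
  proof (cases "x \<in> ball x0 r")
    case True
    define t where "t = r - dist x x0"
    have t: "0 < t" "t \<le> r" using True by (auto simp: t_def dist_commute)
    \<comment> \<open>For each \<open>k < n\<close> one has
      \<open>ln (2 ^ k) \<le> k < ln (r / t)\<close>, hence \<open>t < r / 2 ^ k\<close>, so the
      point lies in at least \<open>n\<close> shells.\<close>
    define n where "n = nat \<lceil>ln (r / t)\<rceil>"
    have n: "ln (r / t) \<le> real n" by (simp add: n_def) linarith
    have "x \<in> A k" if "k < n" for k
    proof -
      have "real k < ln (r / t)" using that by (simp add: n_def) linarith
      then have "ln (2 ^ k) < ln (r / t)" using ln_two_power_le[of k] by linarith
      then have "2 ^ k < r / t" using r t by (subst (asm) ln_less_cancel_iff) auto
      then have "t < r / 2 ^ k" using t by (simp add: field_simps)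
      then show ?thesis using True by (auto simp: A_def t_def dist_commute)
    qed
    then have "(\<Sum>k<n. indicator (A k) x) = (of_nat n :: ennreal)" by simp
    then have "of_nat n \<le> (\<Sum>k. indicator (A k) x :: ennreal)"
      using sum_le_suminf[of "\<lambda>k. indicator (A k) x :: ennreal" "{..<n}"] by auto
    moreover have "ennreal (ln (r / t)) \<le> of_nat n"
      using n by (metis ennreal_leI ennreal_of_nat_eq_real_of_nat)
    ultimately have "ennreal (ln (r / t)) \<le> (\<Sum>k. indicator (A k) x)"
      by (rule order_trans[rotated])
    then show ?thesis using True by (simp add: t_def)
  qed auto
  then have "(\<integral>\<^sup>+x\<in>ball x0 r. ennreal (ln (r / (r - dist x x0))) \<partial>lebesgue) \<le> (\<integral>\<^sup>+x. (\<Sum>k. indicator (A k) x) \<partial>lebesgue)"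
    by (intro nn_integral_mono)
  also have "\<dots> = (\<Sum>k. emeasure lebesgue (A k))"
    by (subst nn_integral_suminf) auto
  also have "\<dots> \<le> (\<Sum>k. ennreal (2 * (pi * r\<^sup>2) * (1 / 2) ^ k))"
  proof (intro suminf_le allI)
    fix k
    define q where "q = (1 / 2 :: real) ^ k"
    have q: "0 < q" "q \<le> 1" by (auto simp: q_def power_le_one)
    have A: "A k = ball x0 r - ball x0 (r * (1 - q))"
      by (simp add: A_def q_def power_divide algebra_simps)
    have "emeasure lebesgue (A k) = emeasure lebesgue (ball x0 r) - emeasure lebesgue (ball x0 (r * (1 - q)))"
      unfolding A using r q by (intro emeasure_Diff) (auto simp: emeasure_ball_plane ball_subset_ball_iff algebra_simps)
    also have "\<dots> = ennreal (pi * r\<^sup>2 - pi * (r * (1 - q))\<^sup>2)"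
      using r q by (simp add: emeasure_ball_plane ennreal_minus)
    \<comment> \<open>This is \<open>1 - (1 - q)\<^sup>2 \<le> 2 * q\<close>.\<close>
    also have "\<dots> \<le> ennreal (2 * (pi * r\<^sup>2) * q)"
      by (intro ennreal_leI) (use q in \<open>simp add: power2_eq_square algebra_simps\<close>)
    finally show "emeasure lebesgue (A k) \<le> ennreal (2 * (pi * r\<^sup>2) * (1 / 2) ^ k)" by (simp add: q_def)
  qed auto
  also have "\<dots> = ennreal (4 * (pi * r\<^sup>2))"
    by (rule suminf_ennreal_eq) (use sums_mult[OF geometric_sums[of "1/2::real"], of "2 * (pi * r\<^sup>2)"] in auto)
  finally show ?thesis .
qed

section \<open>Averages over balls\<close>

lemma set_integrable_const_ball: "set_integrable lebesgue (ball x r) (\<lambda>_. c)"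
proof -
  have "integrable lebesgue (indicat_real (ball x r))"
    using lmeasurable_ball[of x r] by (simp only: lmeasurable_iff_integrable)
  then show ?thesis unfolding set_integrable_def by (intro integrable_scaleR_left) auto
qed

lemma set_integrable_ball:
  assumes "locally_integrable f"
  shows "set_integrable lebesgue (ball x r) (\<lambda>y. f y - c)"
proof -
  have "set_integrable lebesgue (cball x r) f"
    using assms by (auto simp: locally_integrable_def)
  then have "set_integrable lebesgue (ball x r) f"
    by (rule set_integrable_subset) auto
  moreover have "set_integrable lebesgue (ball x r) (\<lambda>_. c)"
    by (rule set_integrable_const_ball)
  ultimately show ?thesis by (rule set_integral_diff)
qed

lemma Avg_const:
  fixes c :: "'a::euclidean_space"
  assumes "0 < r"
  shows "Avg (ball x r) (\<lambda>_. c) = c"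
proof -
  have "integrable lebesgue (indicat_real (ball x r))"
    using lmeasurable_ball[of x r] by (simp only: lmeasurable_iff_integrable)
  then have "(LINT y:ball x r|lebesgue. c) = measure lebesgue (ball x r) *\<^sub>R c"
    unfolding set_lebesgue_integral_def by (subst integral_scaleR_left) auto
  then show ?thesis using assms by (simp add: Avg_def)
qed

lemma Avg_diff_const:
  assumes "locally_integrable f" "0 < r"
  shows "Avg (ball x r) (\<lambda>y. f y - c) = Avg (ball x r) f - c"
proof -
  have f: "set_integrable lebesgue (ball x r) f" using set_integrable_ball[OF assms(1), of x r 0] by simp
  have c: "set_integrable lebesgue (ball x r) (\<lambda>_. c)"
    by (rule set_integrable_const_ball)
  have "Avg (ball x r) (\<lambda>y. f y - c) = Avg (ball x r) f - Avg (ball x r) (\<lambda>_. c)"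
    using f c by (simp add: Avg_def scaleR_diff_right)
  then show ?thesis using assms by (simp add: Avg_const)
qed

lemma norm_Avg_diff_le:
  assumes "locally_integrable f" "0 < r"
  shows "norm (Avg (ball x r) f - c) \<le> Avg (ball x r) (\<lambda>y. norm (f y - c))"
proof -
  have "norm (Avg (ball x r) (\<lambda>y. f y - c)) \<le> Avg (ball x r) (\<lambda>y. norm (f y - c))"
    unfolding Avg_def using set_integral_norm_bound[OF set_integrable_ball[OF assms(1), of x r c]]
    by (simp add: divide_right_mono)
  then show ?thesis using assms by (simp add: Avg_diff_const)
qed

lemma Avg_norm_diff_le:
  assumes "locally_integrable f" "0 < r"
  shows "Avg (ball x r) (\<lambda>y. norm (f y - c)) \<le> Avg (ball x r) (\<lambda>y. norm (f y - a)) + norm (a - c)"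
proof -
  have i: "set_integrable lebesgue (ball x r) (\<lambda>y. norm (f y - b))" for b
    using set_integrable_ball[OF assms(1)] by (rule set_integrable_norm)
  have c: "set_integrable lebesgue (ball x r) (\<lambda>_. b)" for b :: real
    by (rule set_integrable_const_ball)
  have "(LINT y:ball x r|lebesgue. norm (f y - c)) \<le> (LINT y:ball x r|lebesgue. norm (f y - a) + norm (a - c))"
    by (intro set_integral_mono i set_integral_add c) (use norm_triangle_ineq[of "f _ - a" "a - c"] in simp)
  also have "\<dots> = (LINT y:ball x r|lebesgue. norm (f y - a)) + (LINT y:ball x r|lebesgue. norm (a - c))"
    by (intro set_integral_add i c)
  finally have "Avg (ball x r) (\<lambda>y. norm (f y - c)) \<le> Avg (ball x r) (\<lambda>y. norm (f y - a)) + Avg (ball x r) (\<lambda>_. norm (a - c))"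
    by (simp add: Avg_def flip: add_divide_distrib) (simp add: divide_right_mono)
  then show ?thesis using assms by (simp add: Avg_const)
qed

text \<open>Averages are Bochner integrals, whereas Tonelli's theorem and the change of variables
  are used for extended nonnegative integrals; local integrability lets one pass between the
  two.\<close>

lemma nn_integral_eq_Avg:
  assumes "locally_integrable f" "0 < r"
  shows "(\<integral>\<^sup>+y\<in>ball x r. ennreal (norm (f y - c)) \<partial>lebesgue)
    = ennreal (pi * r\<^sup>2 * Avg (ball x r) (\<lambda>y. norm (f y - c)))"
proof -
  have i: "set_integrable lebesgue (ball x r) (\<lambda>y. norm (f y - c))"
    using set_integrable_ball[OF assms(1)] by (rule set_integrable_norm)
  have "(\<integral>\<^sup>+y\<in>ball x r. ennreal (norm (f y - c)) \<partial>lebesgue)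
    = (\<integral>\<^sup>+y. ennreal (indicator (ball x r) y *\<^sub>R norm (f y - c)) \<partial>lebesgue)"
    by (intro nn_integral_cong) (auto simp: indicator_def)
  also have "\<dots> = ennreal (LINT y:ball x r|lebesgue. norm (f y - c))"
    using i unfolding set_integrable_def set_lebesgue_integral_def by (intro nn_integral_eq_integral) auto
  finally show ?thesis using assms by (simp add: Avg_def measure_ball_plane)
qed

lemma Avg_nonneg: "(\<And>y. 0 \<le> g y) \<Longrightarrow> 0 \<le> Avg D (g :: _ \<Rightarrow> real)"
  by (simp add: Avg_def set_lebesgue_integral_def)

text \<open>In place of Hoelder's inequality, apply \<open>t \<le> 1 + t powr p\<close> to \<open>t = norm (f y) / Lp_norm p f\<close>, with
  the denominator slightly enlarged to avoid division by zero.\<close>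

lemma norm_Avg_le_Lp_norm:
  assumes f: "f \<in> Lp p" "locally_integrable f" and p: "1 \<le> p" and r: "1 / 2 \<le> r"
  shows "norm (Avg (ball x r) f) \<le> 3 * Lp_norm p f"
proof (rule field_le_epsilon)
  fix e :: real assume "0 < e"
  define I where "I = (LINT x|lebesgue. norm (f x) powr p)"
  define s where "s = Lp_norm p f + e / 3"
  have I: "integrable lebesgue (\<lambda>x. norm (f x) powr p)" "I \<ge> 0"
    using f by (auto simp: Lp_def I_def)
  have L: "Lp_norm p f = I powr (1 / p)" by (simp add: Lp_norm_def I_def)
  have s: "s > 0" using \<open>0 < e\<close> unfolding s_def L by (intro add_nonneg_pos) auto
  have "I = (I powr (1 / p)) powr p" using I p by (simp add: powr_powr)
  also have "\<dots> \<le> s powr p" unfolding L[symmetric] using \<open>0 < e\<close> p by (intro powr_mono2) (auto simp: s_def L)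
  finally have Is: "I \<le> s powr p" .
  have fi: "set_integrable lebesgue (ball x r) f" using set_integrable_ball[OF f(2), of x r 0] by simp
  have pw: "norm (f y) \<le> s + s * (norm (f y) powr p / s powr p)" for y
  proof -
    define t where "t = norm (f y) / s"
    have t: "t \<ge> 0" "norm (f y) = s * t" using s by (auto simp: t_def)
    have "t \<le> 1 + t powr p"
    proof (cases "t \<le> 1")
      case True
      then show ?thesis by (smt (verit) powr_ge_zero)
    next
      case False
      then have "t powr 1 \<le> t powr p" using p by (intro powr_mono) auto
      then show ?thesis using t by simp
    qed
    then have "s * t \<le> s * (1 + t powr p)" using s by simp
    then show ?thesis using t s by (simp add: powr_mult algebra_simps)
  qed
  have c: "set_integrable lebesgue (ball x r) (\<lambda>_. s)"
    by (rule set_integrable_const_ball)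
  have I2: "integrable lebesgue (\<lambda>y. s * (norm (f y) powr p / s powr p))"
    using I by auto
  have cI: "integrable lebesgue (\<lambda>y. indicator (ball x r) y *\<^sub>R s)"
    using c by (simp add: set_integrable_def)
  have "(LINT y:ball x r|lebesgue. norm (f y)) \<le> (LINT y|lebesgue. indicator (ball x r) y *\<^sub>R s + s * (norm (f y) powr p / s powr p))"
    unfolding set_lebesgue_integral_def
  proof (intro integral_mono Bochner_Integration.integrable_add I2 cI)
    show "integrable lebesgue (\<lambda>y. indicator (ball x r) y *\<^sub>R norm (f y))"
      using set_integrable_norm[OF fi] by (simp add: set_integrable_def)
    show "indicator (ball x r) y *\<^sub>R norm (f y) \<le> indicator (ball x r) y *\<^sub>R s + s * (norm (f y) powr p / s powr p)" for y
      using pw[of y] s by (auto simp: indicator_def)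
  qed
  also have "\<dots> = pi * r\<^sup>2 * s + s * (I / s powr p)"
    using I2 cI r by (simp add: I_def measure_ball_plane)
  also have "\<dots> \<le> pi * r\<^sup>2 * s + s * 1"
    using Is s by (intro add_left_mono mult_left_mono) (auto simp: divide_le_eq_1)
  finally have i: "(LINT y:ball x r|lebesgue. norm (f y)) \<le> pi * r\<^sup>2 * s + s" by simp
  have "norm (Avg (ball x r) f) \<le> Avg (ball x r) (\<lambda>y. norm (f y - 0))"
    using norm_Avg_diff_le[OF f(2), of r x 0] r by simp
  also have "\<dots> = (LINT y:ball x r|lebesgue. norm (f y)) / (pi * r\<^sup>2)"
    using r by (simp add: Avg_def measure_ball_plane)
  also have "\<dots> \<le> (pi * r\<^sup>2 * s + s) / (pi * r\<^sup>2)"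
    using i by (intro divide_right_mono) auto
  also have "\<dots> = s + s / (pi * r\<^sup>2)" using r by (simp add: field_simps)
  \<comment> \<open>Since \<open>r \<ge> 1 / 2\<close>, the area is at least 3/4, so the total is at
    most \<open>3 * s\<close>, which equals \<open>3 * Lp_norm p f + e\<close> by the choice of
    \<open>s\<close>.\<close>
  also have "s / (pi * r\<^sup>2) \<le> s / (1/2)"
  proof -
    have "3 * (1/2)\<^sup>2 \<le> pi * r\<^sup>2" using r pi_gt3 by (intro mult_mono power_mono) auto
    then show ?thesis using s by (intro divide_left_mono) (auto simp: power2_eq_square)
  qed
  finally show "norm (Avg (ball x r) f) \<le> 3 * Lp_norm p f + e" by (simp add: s_def)
qed

section \<open>Change of variables by measure preserving homeomorphisms\<close>

lemma set_nn_integral_image: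
  fixes g :: "real^2 \<Rightarrow> ennreal"
  assumes \<psi>: "measure_preserving_homeomorphism \<psi>" and B: "open B"
    and [measurable]: "g \<in> borel_measurable lebesgue"
  shows "(\<integral>\<^sup>+x\<in>B. g (\<psi> x) \<partial>lebesgue) = (\<integral>\<^sup>+y\<in>\<psi> ` B. g y \<partial>lebesgue)"
proof -
  obtain \<phi> where h: "homeomorphism UNIV UNIV \<psi> \<phi>"
    and m [measurable]: "\<psi> \<in> lebesgue \<rightarrow>\<^sub>M lebesgue" and d: "distr lebesgue lebesgue \<psi> = lebesgue"
    using \<psi> by (auto simp: measure_preserving_homeomorphism_def)
  have "open (\<psi> ` B)" using h B homeomorphism_imp_open_map by fastforce
  then have [measurable]: "\<psi> ` B \<in> sets lebesgue" by simp
  have inj: "\<phi> (\<psi> x) = x" for x using h by (simp add: homeomorphism_def)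
  have "(\<integral>\<^sup>+y\<in>\<psi> ` B. g y \<partial>lebesgue) = (\<integral>\<^sup>+y\<in>\<psi> ` B. g y \<partial>distr lebesgue lebesgue \<psi>)"
    by (simp only: d)
  also have "\<dots> = (\<integral>\<^sup>+x. g (\<psi> x) * indicator (\<psi> ` B) (\<psi> x) \<partial>lebesgue)"
    by (rule nn_integral_distr) measurable
  also have "\<dots> = (\<integral>\<^sup>+x\<in>B. g (\<psi> x) \<partial>lebesgue)"
    by (intro nn_integral_cong arg_cong2[where f = "(*)"] refl) (auto simp: indicator_def dest: arg_cong[of _ _ \<phi>] simp: inj)
  finally show ?thesis ..
qed

lemma locally_integrable_comp:
  assumes \<psi>: "measure_preserving_homeomorphism \<psi>" and f: "locally_integrable f"
  shows "locally_integrable (f \<circ> \<psi>)"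
  unfolding locally_integrable_def
proof (intro allI impI)
  fix K :: "(real^2) set" assume K: "compact K"
  obtain \<phi> where h: "homeomorphism UNIV UNIV \<psi> \<phi>"
    and m: "\<psi> \<in> lebesgue \<rightarrow>\<^sub>M lebesgue" and d: "distr lebesgue lebesgue \<psi> = lebesgue"
    using \<psi> by (auto simp: measure_preserving_homeomorphism_def)
  have inj: "\<phi> (\<psi> x) = x" for x using h by (simp add: homeomorphism_def)
  have "continuous_on K \<psi>" using h by (auto simp: homeomorphism_def intro: continuous_on_subset)
  then have "compact (\<psi> ` K)" using K by (rule compact_continuous_image)
  then have "integrable lebesgue (\<lambda>x. indicator (\<psi> ` K) x *\<^sub>R f x)"
    using f by (auto simp: locally_integrable_def set_integrable_def)
  then have "integrable (distr lebesgue lebesgue \<psi>) (\<lambda>x. indicator (\<psi> ` K) x *\<^sub>R f x)"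
    by (simp only: d)
  then have "integrable lebesgue (\<lambda>x. indicator (\<psi> ` K) (\<psi> x) *\<^sub>R f (\<psi> x))"
    by (rule integrable_distr[OF m])
  also have "(\<lambda>x. indicator (\<psi> ` K) (\<psi> x) *\<^sub>R f (\<psi> x)) = (\<lambda>x. indicator K x *\<^sub>R (f \<circ> \<psi>) x)"
    by (intro ext) (auto simp: indicator_def dest: arg_cong[of _ _ \<phi>] simp: inj)
  finally show "f \<circ> \<psi> absolutely_integrable_on K" by (simp add: set_integrable_def)
qed

lemma Lp_comp:
  assumes \<psi>: "measure_preserving_homeomorphism \<psi>" and f: "f \<in> Lp p"
  shows "f \<circ> \<psi> \<in> Lp p" "Lp_norm p (f \<circ> \<psi>) = Lp_norm p f"
proof -
  have m: "\<psi> \<in> lebesgue \<rightarrow>\<^sub>M lebesgue" and d: "distr lebesgue lebesgue \<psi> = lebesgue"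
    using \<psi> by (auto simp: measure_preserving_homeomorphism_def)
  have fm [measurable]: "f \<in> borel_measurable lebesgue"
    and fi: "integrable (distr lebesgue lebesgue \<psi>) (\<lambda>x. norm (f x) powr p)"
    using f by (simp_all add: Lp_def d)
  show "f \<circ> \<psi> \<in> Lp p"
    using integrable_distr[OF m fi] measurable_comp[OF m fm] by (simp add: Lp_def)
  have "(LINT x|lebesgue. norm (f x) powr p) = (LINT x|distr lebesgue lebesgue \<psi>. norm (f x) powr p)"
    by (simp only: d)
  also have "\<dots> = (LINT x|lebesgue. norm (f (\<psi> x)) powr p)"
    by (rule integral_distr[OF m]) measurable
  finally show "Lp_norm p (f \<circ> \<psi>) = Lp_norm p f" by (simp add: Lp_norm_def)
qed

lemma measure_preserving_homeomorphism_inject: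
  assumes "measure_preserving_homeomorphism \<psi>"
  shows "\<psi> x = \<psi> y \<longleftrightarrow> x = y"
proof -
  obtain \<phi> where "\<And>x. \<phi> (\<psi> x) = x"
    using assms by (auto simp: measure_preserving_homeomorphism_def homeomorphism_def)
  then show ?thesis by metis
qed

lemma double_ball_subsetD:
  fixes x1 x2 :: "'a::euclidean_space"
  assumes "0 < r2" "ball x2 (2 * r2) \<subseteq> ball x1 r1"
  shows "r2 \<le> r1" "dist x2 x1 < r1"
proof -
  have "dist x2 x1 + 2 * r2 \<le> r1" using assms by (simp add: ball_subset_ball_iff)
  then show "r2 \<le> r1" "dist x2 x1 < r1" using assms(1) zero_le_dist[of x2 x1] by linarith+
qed

section \<open>Functions with controlled oscillation and averages\<close>

text \<open>One real constant \<open>N\<close> replaces the full norm. The assumptions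
  \<open>osc\<close> and \<open>diff\<close> express the LBMO part, while \<open>large\<close> is
  how the Lp part enters: it anchors averages at unit scale, which differences of averages alone
  cannot do.\<close>

locale lbmo_function =
  fixes f :: "real^2 \<Rightarrow> complex" and N :: real
  assumes meas [measurable]: "f \<in> borel_measurable lebesgue"
    and loc: "locally_integrable f"
    and osc: "0 < r \<Longrightarrow> Avg (ball x r) (\<lambda>y. norm (f y - Avg (ball x r) f)) \<le> N"
    and diff: "0 < r1 \<Longrightarrow> r1 \<le> 1 \<Longrightarrow> 0 < r2 \<Longrightarrow> ball x2 (2 * r2) \<subseteq> ball x1 r1 \<Longrightarrow>
      norm (Avg (ball x2 r2) f - Avg (ball x1 r1) f) \<le> N * (1 + llog r2 - llog r1)"
    and large: "1 / 2 \<le> r \<Longrightarrow> norm (Avg (ball x r) f) \<le> 3 * N"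
begin

lemma N_nonneg: "0 \<le> N"
  using osc[of 1 0] Avg_nonneg[of "\<lambda>y. norm (f y - Avg (ball 0 1) f)" "ball 0 1"] by simp

text \<open>A ball of radius below 1/2 is compared by \<open>diff\<close> with the concentric unit
  ball, whose average is bounded by \<open>large\<close>.\<close>

lemma norm_Avg_le:
  assumes "0 < r"
  shows "norm (Avg (ball x r) f) \<le> N * (4 + llog r)"
proof (cases "1 / 2 \<le> r")
  case True
  then have "norm (Avg (ball x r) f) \<le> N * 3" using large[of r x] by simp
  also have "\<dots> \<le> N * (4 + llog r)" using N_nonneg llog_nonneg[of r] by (intro mult_left_mono) auto
  finally show ?thesis .
next
  case False
  then have "norm (Avg (ball x r) f - Avg (ball x 1) f) \<le> N * (1 + llog r - llog 1)"
    using assms by (intro diff subset_ball) auto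
  then have "norm (Avg (ball x r) f) \<le> N * (1 + llog r) + 3 * N"
    using large[of 1 x] norm_triangle_sub[of "Avg (ball x r) f" "Avg (ball x 1) f"]
    by (simp add: llog_eq_0)
  then show ?thesis by (simp add: algebra_simps)
qed

end

section \<open>Composition with a homeomorphism distorting \<open>llog\<close> by at most
  \<open>\<kappa>\<close>\<close>

locale lbmo_composition = lbmo_function +
  fixes \<psi> :: "real^2 \<Rightarrow> real^2" and \<kappa> :: real
  assumes mph: "measure_preserving_homeomorphism \<psi>"
    and \<kappa>: "0 \<le> \<kappa>"
    and llog_expand: "x \<noteq> y \<Longrightarrow> llog (dist (\<psi> x) (\<psi> y)) \<le> llog (dist x y) + \<kappa>"
    and llog_contract: "x \<noteq> y \<Longrightarrow> llog (dist x y) \<le> llog (dist (\<psi> x) (\<psi> y)) + \<kappa>"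
begin

text \<open>The image of a small ball \<open>ball x r\<close> lies in \<open>cball (\<psi> x) (radius r)\<close>, so \<open>f \<circ> \<psi>\<close> is compared with
  the average of \<open>f\<close> over a multiple of that ball. On other balls the comparison value \<open>0\<close> suffices, since
  averages of \<open>f\<close> over balls of radius \<open>s\<close> are of size \<open>4 + llog s\<close> at most.\<close>

definition radius :: "real \<Rightarrow> real" where
  "radius r = exp (1 - exp (llog r - \<kappa>))"

definition centre :: "real^2 \<Rightarrow> real \<Rightarrow> complex" where
  "centre x r = (if llog r \<le> \<kappa> + 5 then 0 else Avg (ball (\<psi> x) (4 * radius r)) f)"

lemma radius_pos: "0 < radius r"
  by (simp add: radius_def)

text \<open>The formula for \<open>radius\<close> inverts \<open>llog\<close> on its branch
  \<open>s \<le> 1\<close>; the condition \<open>\<kappa> \<le> llog r\<close> makes the exponent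
  nonpositive, so that this branch is the right one.\<close>

lemma llog_radius: "\<kappa> \<le> llog r \<Longrightarrow> llog (radius r) = llog r - \<kappa>"
  by (simp add: radius_def llog_def)

text \<open>The factor 16 is \<open>2 ^ 4\<close> and costs at most 4. The threshold
  \<open>\<kappa> + 5\<close> therefore keeps \<open>llog (16 * radius r)\<close> positive, so all
  enlarged image balls have radius at most 1 and \<open>diff\<close> applies to them.\<close>

lemma llog_mult_radius:
  assumes "\<kappa> + 5 < llog r"
  shows "llog (4 * radius r) \<le> llog r - \<kappa>" "llog r - \<kappa> - 4 \<le> llog (16 * radius r)"
  using llog_antimono[of "radius r" "4 * radius r"] llog_scale[of "radius r" 4] assms
  by (simp_all add: radius_pos llog_radius less_imp_le)

lemma radius_le_16:
  assumes "\<kappa> + 5 < llog r"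
  shows "16 * radius r \<le> 1"
  using llog_mult_radius(2)[OF assms] llog_eq_0[of "16 * radius r"] assms by linarith

lemma inj: "\<psi> x = \<psi> y \<longleftrightarrow> x = y"
  by (rule measure_preserving_homeomorphism_inject[OF mph])

lemma dist_image_le:
  assumes "\<kappa> < llog r" "dist x y < r"
  shows "dist (\<psi> x) (\<psi> y) \<le> radius r"
proof (cases "x = y")
  case False
  have "llog r \<le> llog (dist x y)" using False assms by (intro llog_antimono) auto
  then have "llog (radius r) \<le> llog (dist (\<psi> x) (\<psi> y))"
    using llog_contract[OF False] assms by (simp add: llog_radius)
  moreover have "0 < llog (radius r)"
    using assms by (simp add: llog_radius)
  moreover have "0 < dist (\<psi> x) (\<psi> y)" using False by (simp add: inj)
  ultimately show ?thesis using le_of_llog_le radius_pos by blast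
qed (simp add: less_imp_le[OF radius_pos])

lemma image_ball:
  shows "open (\<psi> ` ball x r)" "\<psi> ` ball x r \<noteq> UNIV"
proof -
  obtain \<phi> where h: "homeomorphism UNIV UNIV \<psi> \<phi>"
    using mph by (auto simp: measure_preserving_homeomorphism_def)
  show "open (\<psi> ` ball x r)" using h homeomorphism_imp_open_map by fastforce
  have "ball x r \<noteq> UNIV" by (metis bounded_ball not_bounded_UNIV)
  then obtain y where "y \<notin> ball x r" by (metis UNIV_eq_I)
  then have "\<psi> y \<notin> \<psi> ` ball x r" by (auto simp: inj)
  then show "\<psi> ` ball x r \<noteq> UNIV" by auto
qed

lemma infdist_image_pos: "z \<in> \<psi> ` ball x0 r \<Longrightarrow> 0 < infdist z (- (\<psi> ` ball x0 r))"
proof (rule infdist_pos_not_in_closed)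
  show "closed (- (\<psi> ` ball x0 r))" using image_ball(1) by (rule closed_Compl)
  show "- (\<psi> ` ball x0 r) \<noteq> {}" using image_ball(2)[of x0 r] by (metis Compl_empty_eq double_complement)
qed simp

text \<open>The nearest point of the complement is \<open>\<psi> y\<close> for some \<open>y\<close>
  outside the ball, so \<open>x\<close> and \<open>y\<close> are at least
  \<open>r - dist x x0\<close> apart, and \<open>llog_expand\<close> carries this over to the
  images.\<close>

lemma llog_infdist_image:
  assumes "x \<in> ball x0 r"
  shows "llog (infdist (\<psi> x) (- (\<psi> ` ball x0 r))) \<le> \<kappa> + llog r + ln (r / (r - dist x x0))"
proof -
  obtain \<phi> where h: "homeomorphism UNIV UNIV \<psi> \<phi>"
    using mph by (auto simp: measure_preserving_homeomorphism_def)
  obtain w where w: "w \<in> - (\<psi> ` ball x0 r)" "infdist (\<psi> x) (- (\<psi> ` ball x0 r)) = dist (\<psi> x) w"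
    using infdist_attains_inf[of "- (\<psi> ` ball x0 r)" "\<psi> x"] image_ball[of x0 r] by auto
  define y where "y = \<phi> w"
  have y: "w = \<psi> y" using h by (simp add: y_def homeomorphism_def)
  then have yB: "y \<notin> ball x0 r" using w by auto
  then have xy: "x \<noteq> y" using assms by auto
  have *: "0 < r - dist x x0" "r - dist x x0 \<le> dist x y"
    using assms yB dist_triangle[of x0 y x] by (auto simp: dist_commute)
  have "llog (dist (\<psi> x) (\<psi> y)) \<le> llog (dist x y) + \<kappa>" by (rule llog_expand[OF xy])
  also have "llog (dist x y) \<le> llog (r - dist x x0)" using * by (rule llog_antimono)
  also have "\<dots> \<le> llog r + ln (r / (r - dist x x0))" using * by (intro llog_le_add_ln) auto
  finally show ?thesis using w y by simp
qed

text \<open>Below the threshold the comparison value is 0, and \<open>4 + llog (d / 4)\<close> with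
  \<open>llog r \<le> \<kappa> + 5\<close> gives 11 = 4 + 5 + 2. Above it, \<open>llog r\<close>
  cancels between the small ball and the ball defining \<open>centre\<close>.\<close>

lemma norm_Avg_diff_centre:
  assumes x: "x \<in> ball x0 r"
  defines "d \<equiv> infdist (\<psi> x) (- (\<psi> ` ball x0 r))"
  shows "norm (Avg (ball (\<psi> x) (d / 4)) f - centre x0 r) \<le> N * (11 + 2 * \<kappa> + ln (r / (r - dist x x0)))"
proof -
  have d: "0 < d" using x unfolding d_def by (intro infdist_image_pos) auto
  have l: "llog (d / 4) \<le> \<kappa> + llog r + ln (r / (r - dist x x0)) + 2"
    using llog_infdist_image[OF x] llog_scale[of "d / 4" 2] d by (simp add: d_def)
  show ?thesis
  proof (cases "llog r \<le> \<kappa> + 5")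
    case True
    then have "norm (Avg (ball (\<psi> x) (d / 4)) f - centre x0 r) \<le> N * (4 + llog (d / 4))"
      using norm_Avg_le[of "d / 4" "\<psi> x"] d by (simp add: centre_def)
    also have "\<dots> \<le> N * (11 + 2 * \<kappa> + ln (r / (r - dist x x0)))"
      using l True N_nonneg by (intro mult_left_mono) auto
    finally show ?thesis .
  next
    case False
    \<comment> \<open>The two inclusions put the double of the small ball inside the ball defining
      \<open>centre\<close>, as \<open>diff\<close> requires.\<close>
    have "ball (\<psi> x) d \<subseteq> \<psi> ` ball x0 r"
    proof
      fix y assume y: "y \<in> ball (\<psi> x) d"
      show "y \<in> \<psi> ` ball x0 r"
      proof (rule ccontr)
        assume "y \<notin> \<psi> ` ball x0 r"
        then have "d \<le> dist (\<psi> x) y" unfolding d_def by (intro infdist_le) auto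
        then show False using y by auto
      qed
    qed
    also have "\<dots> \<subseteq> ball (\<psi> x0) (4 * radius r)"
    proof
      fix z assume "z \<in> \<psi> ` ball x0 r"
      then obtain y where "z = \<psi> y" "dist x0 y < r" by auto
      then show "z \<in> ball (\<psi> x0) (4 * radius r)"
        using dist_image_le[of r x0 y] False radius_pos[of r] by simp
    qed
    finally have "ball (\<psi> x) (2 * (d / 4)) \<subseteq> ball (\<psi> x0) (4 * radius r)"
      using subset_ball[of "2 * (d / 4)" d "\<psi> x"] d by auto
    then have "norm (Avg (ball (\<psi> x) (d / 4)) f - Avg (ball (\<psi> x0) (4 * radius r)) f)
      \<le> N * (1 + llog (d / 4) - llog (4 * radius r))"
      using d False radius_pos[of r] radius_le_16[of r] by (intro diff) auto
    also have "\<dots> \<le> N * (11 + 2 * \<kappa> + ln (r / (r - dist x x0)))"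
    proof (intro mult_left_mono N_nonneg)
      have "llog r - \<kappa> - 4 \<le> llog (4 * radius r)"
        using llog_mult_radius(2)[of r] llog_antimono[of "4 * radius r" "16 * radius r"] False radius_pos[of r] by auto
      then show "1 + llog (d / 4) - llog (4 * radius r) \<le> 11 + 2 * \<kappa> + ln (r / (r - dist x x0))"
        using l by linarith
    qed
    finally show ?thesis using False by (simp add: centre_def)
  qed
qed

lemma loc_comp: "locally_integrable (f \<circ> \<psi>)"
  by (rule locally_integrable_comp[OF mph loc])

text \<open>The integral is moved to \<open>U\<close>, replaced there by averages over the balls
  \<open>ball z (d z / 4)\<close>, and the bound on these averages is moved back to
  \<open>B\<close>, where its logarithm is integrable. The constant is 36 = 9/4 * (12 + 4), with 4
  from \<open>set_nn_integral_ln_ball\<close>.\<close>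

lemma Avg_comp_diff_centre:
  assumes r: "0 < r"
  shows "Avg (ball x0 r) (\<lambda>x. norm ((f \<circ> \<psi>) x - centre x0 r)) \<le> 36 * (1 + \<kappa>) * N"
proof -
  obtain \<phi> where h: "homeomorphism UNIV UNIV \<psi> \<phi>"
    using mph by (auto simp: measure_preserving_homeomorphism_def)
  define c where "c = centre x0 r"
  define B where "B = ball x0 r"
  define U where "U = \<psi> ` B"
  define d where "d = (\<lambda>z. infdist z (- U))"
  define g where "g = (\<lambda>y. ennreal (norm (f y - c)))"
  \<comment> \<open>The 12 is the 11 of \<open>norm_Avg_diff_centre\<close> plus 1 for the
    oscillation of \<open>f\<close> on the small ball. The bound depends on the preimage
    \<open>x\<close>, so on \<open>U\<close> it appears as \<open>G \<circ> \<phi>\<close>.\<close>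
  define G where "G = (\<lambda>x. ennreal (N * (12 + 2 * \<kappa> + ln (r / (r - dist x x0)))))"
  have [measurable]: "g \<in> borel_measurable lebesgue" unfolding g_def by measurable
  have \<phi>\<psi>: "\<phi> (\<psi> x) = x" for x using h by (simp add: homeomorphism_def)
  have "\<phi> \<in> borel_measurable borel"
    using h by (intro borel_measurable_continuous_onI) (simp add: homeomorphism_def)
  then have "G \<circ> \<phi> \<in> borel_measurable borel" unfolding G_def o_def by measurable
  then have [measurable]: "G \<circ> \<phi> \<in> borel_measurable lebesgue" by (simp add: measurable_completion)
  have U: "open U" "U \<noteq> UNIV" using image_ball by (auto simp: U_def B_def)
  have avg: "(\<integral>\<^sup>+y\<in>ball z (d z / 4). g y \<partial>lebesgue) * ennreal (1 / (pi * (d z / 4)\<^sup>2)) \<le> (G \<circ> \<phi>) z"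
    if z: "z \<in> U" for z
  proof -
    obtain x where x: "x \<in> B" "z = \<psi> x" using z by (auto simp: U_def)
    have dz: "0 < d z" using infdist_image_pos z by (simp add: d_def U_def B_def)
    have "(\<integral>\<^sup>+y\<in>ball z (d z / 4). g y \<partial>lebesgue) * ennreal (1 / (pi * (d z / 4)\<^sup>2))
      = ennreal (Avg (ball z (d z / 4)) (\<lambda>y. norm (f y - c)))"
      using dz unfolding g_def
      by (subst nn_integral_eq_Avg[OF loc]) (auto simp: Avg_nonneg simp flip: ennreal_mult)
    also have "\<dots> \<le> ennreal (N * (12 + 2 * \<kappa> + ln (r / (r - dist x x0))))"
    proof (rule ennreal_leI)
      have "Avg (ball z (d z / 4)) (\<lambda>y. norm (f y - c))
        \<le> Avg (ball z (d z / 4)) (\<lambda>y. norm (f y - Avg (ball z (d z / 4)) f)) + norm (Avg (ball z (d z / 4)) f - c)"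
        using dz by (intro Avg_norm_diff_le loc) auto
      also have "\<dots> \<le> N + N * (11 + 2 * \<kappa> + ln (r / (r - dist x x0)))"
        using norm_Avg_diff_centre[of x x0 r] x dz
        by (intro add_mono osc) (auto simp: c_def d_def U_def B_def)
      finally show "Avg (ball z (d z / 4)) (\<lambda>y. norm (f y - c)) \<le> N * (12 + 2 * \<kappa> + ln (r / (r - dist x x0)))"
        by (simp add: algebra_simps)
    qed
    finally show ?thesis by (simp add: x G_def \<phi>\<psi>)
  qed
  have "ennreal (pi * r\<^sup>2 * Avg B (\<lambda>x. norm ((f \<circ> \<psi>) x - c))) = (\<integral>\<^sup>+x\<in>B. g (\<psi> x) \<partial>lebesgue)"
    unfolding B_def using nn_integral_eq_Avg[OF loc_comp r] by (simp add: g_def)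
  also have "\<dots> = (\<integral>\<^sup>+y\<in>U. g y \<partial>lebesgue)"
    unfolding U_def by (rule set_nn_integral_image[OF mph]) (auto simp: B_def)
  also have "\<dots> \<le> ennreal (9 / 4) * (\<integral>\<^sup>+z\<in>U. ((\<integral>\<^sup>+y\<in>ball z (d z / 4). g y \<partial>lebesgue)
                                * ennreal (1 / (pi * (d z / 4)\<^sup>2))) \<partial>lebesgue)"
    unfolding d_def by (rule set_nn_integral_le_averages[OF _ U]) measurable
  also have "\<dots> \<le> ennreal (9 / 4) * (\<integral>\<^sup>+z\<in>U. (G \<circ> \<phi>) z \<partial>lebesgue)"
    using avg by (intro mult_left_mono nn_integral_mono) (auto simp: indicator_def simp del: o_apply)
  also have "(\<integral>\<^sup>+z\<in>U. (G \<circ> \<phi>) z \<partial>lebesgue) = (\<integral>\<^sup>+x\<in>B. (G \<circ> \<phi>) (\<psi> x) \<partial>lebesgue)"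
    unfolding U_def by (rule set_nn_integral_image[OF mph, symmetric]) (auto simp: B_def simp del: o_apply)
  also have "\<dots> = (\<integral>\<^sup>+x. ennreal (N * (12 + 2 * \<kappa>)) * indicator B x
      + ennreal N * (ennreal (ln (r / (r - dist x x0))) * indicator B x) \<partial>lebesgue)"
  proof (rule nn_integral_cong)
    fix x
    \<comment> \<open>\<open>ennreal\<close> truncates negative values, so it splits the sum only
      because the logarithm is nonnegative on \<open>B\<close>.\<close>
    have "0 \<le> ln (r / (r - dist x x0))" if "x \<in> B"
      using that by (auto simp: B_def dist_commute)
    then show "(G \<circ> \<phi>) (\<psi> x) * indicator B x = ennreal (N * (12 + 2 * \<kappa>)) * indicator B x
      + ennreal N * (ennreal (ln (r / (r - dist x x0))) * indicator B x)"
      using N_nonneg \<kappa>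
      by (auto simp: G_def \<phi>\<psi> indicator_def distrib_left simp flip: ennreal_mult ennreal_plus)
  qed
  also have "\<dots> = ennreal (N * (12 + 2 * \<kappa>)) * emeasure lebesgue B
      + ennreal N * (\<integral>\<^sup>+x\<in>B. ennreal (ln (r / (r - dist x x0))) \<partial>lebesgue)"
  proof -
    have [measurable]: "B \<in> sets lebesgue" by (simp add: B_def)
    have [measurable]: "(\<lambda>x. ennreal (ln (r / (r - dist x x0)))) \<in> borel_measurable lebesgue"
      by (intro measurable_completion) measurable
    show ?thesis by (subst nn_integral_add) (auto simp: nn_integral_cmult)
  qed
  also have "\<dots> \<le> ennreal (N * (12 + 2 * \<kappa>)) * ennreal (pi * r\<^sup>2) + ennreal N * ennreal (4 * (pi * r\<^sup>2))"
    using r by (intro add_mono mult_left_mono) (auto simp: B_def emeasure_ball_plane set_nn_integral_ln_ball)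
  also have "\<dots> = ennreal (N * (16 + 2 * \<kappa>) * (pi * r\<^sup>2))"
    using N_nonneg \<kappa> by (simp add: algebra_simps flip: ennreal_mult ennreal_plus)
  finally have "ennreal (pi * r\<^sup>2 * Avg B (\<lambda>x. norm ((f \<circ> \<psi>) x - c)))
      \<le> ennreal (9 / 4) * ennreal (N * (16 + 2 * \<kappa>) * (pi * r\<^sup>2))"
    by (simp add: mult_left_mono)
  then have "pi * r\<^sup>2 * Avg B (\<lambda>x. norm ((f \<circ> \<psi>) x - c)) \<le> 9 / 4 * (N * (16 + 2 * \<kappa>) * (pi * r\<^sup>2))"
    using N_nonneg \<kappa> by (subst (asm) ennreal_mult[symmetric]) (auto simp: ennreal_le_iff)
  also have "\<dots> = pi * r\<^sup>2 * (9 / 4 * (N * (16 + 2 * \<kappa>)))" by simp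
  finally have "Avg B (\<lambda>x. norm ((f \<circ> \<psi>) x - c)) \<le> 9 / 4 * (N * (16 + 2 * \<kappa>))"
    using r by (subst (asm) mult_le_cancel_left_pos) auto
  also have "\<dots> \<le> 36 * (1 + \<kappa>) * N"
    using mult_nonneg_nonneg[OF \<kappa> N_nonneg] by (simp add: algebra_simps)
  finally show ?thesis by (simp add: B_def c_def)
qed

lemma norm_Avg_comp_diff_centre:
  "0 < r \<Longrightarrow> norm (Avg (ball x r) (f \<circ> \<psi>) - centre x r) \<le> 36 * (1 + \<kappa>) * N"
  by (rule order_trans[OF norm_Avg_diff_le[OF loc_comp] Avg_comp_diff_centre])

text \<open>Replacing \<open>centre\<close> by the true average costs a second copy of the
  bound.\<close>

lemma osc_comp:
  assumes "0 < r"
  shows "Avg (ball x r) (\<lambda>y. norm ((f \<circ> \<psi>) y - Avg (ball x r) (f \<circ> \<psi>))) \<le> 72 * (1 + \<kappa>) * N"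
proof -
  have "Avg (ball x r) (\<lambda>y. norm ((f \<circ> \<psi>) y - Avg (ball x r) (f \<circ> \<psi>)))
    \<le> Avg (ball x r) (\<lambda>y. norm ((f \<circ> \<psi>) y - centre x r)) + norm (centre x r - Avg (ball x r) (f \<circ> \<psi>))"
    by (rule Avg_norm_diff_le[OF loc_comp assms])
  also have "\<dots> \<le> 36 * (1 + \<kappa>) * N + 36 * (1 + \<kappa>) * N"
    using norm_Avg_comp_diff_centre[OF assms, of x]
    by (intro add_mono Avg_comp_diff_centre assms) (simp add: norm_minus_commute)
  also have "\<dots> = 72 * (1 + \<kappa>) * N" by (simp add: algebra_simps)
  finally show ?thesis .
qed

text \<open>As \<open>llog r1 \<le> llog r2\<close>, the larger ball cannot be above the threshold
  while the smaller one is below it, which leaves three cases. With only the smaller one above,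
  \<open>llog r1 \<le> \<kappa> + 5\<close> lets the difference of \<open>llog\<close> values absorb
  the size of its average.\<close>

lemma norm_centre_diff:
  assumes r: "0 < r1" "r1 \<le> 1" "0 < r2" and sub: "ball x2 (2 * r2) \<subseteq> ball x1 r1"
  shows "norm (centre x2 r2 - centre x1 r1) \<le> N * (10 * (1 + llog r2 - llog r1))"
proof -
  note r12 = double_ball_subsetD[OF r(3) sub]
  have l: "llog r1 \<le> llog r2" using r r12 by (intro llog_antimono) auto
  consider "llog r2 \<le> \<kappa> + 5" "llog r1 \<le> \<kappa> + 5" | "\<kappa> + 5 < llog r2" "llog r1 \<le> \<kappa> + 5"
    | "\<kappa> + 5 < llog r2" "\<kappa> + 5 < llog r1" using l by linarith
  then show ?thesis
  proof cases
    case 1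
    then show ?thesis using N_nonneg l by (simp add: centre_def)
  next
    case 2
    then have "norm (centre x2 r2 - centre x1 r1) \<le> N * (4 + llog (4 * radius r2))"
      using norm_Avg_le[of "4 * radius r2" "\<psi> x2"] by (simp add: centre_def radius_pos)
    also have "\<dots> \<le> N * (10 * (1 + llog r2 - llog r1))"
      using 2 llog_mult_radius(1)[of r2] l N_nonneg by (intro mult_left_mono) auto
    finally show ?thesis .
  next
    case 3
    \<comment> \<open>The balls defining the two centres need not be nested with room for doubling.
      The ball of radius \<open>16 * radius r1\<close> about \<open>\<psi> x1\<close> contains the
      doubles of both, since \<open>8 * radius r2 + dist (\<psi> x2) (\<psi> x1) \<le> 9 * radius
      r1\<close>.\<close>
    define b where "b = Avg (ball (\<psi> x1) (16 * radius r1)) f"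
    have R: "radius r2 \<le> radius r1" using l by (simp add: radius_def)
    have D: "dist (\<psi> x2) (\<psi> x1) \<le> radius r1" using 3 r12 \<kappa> by (intro dist_image_le) auto
    have "norm (centre x2 r2 - b) \<le> N * (1 + llog (4 * radius r2) - llog (16 * radius r1))"
      using 3 R D radius_pos radius_le_16[of r1] unfolding b_def centre_def
      by (simp, intro diff) (auto simp: ball_subset_ball_iff)
    also have "\<dots> \<le> N * (5 + llog r2 - llog r1)"
      using llog_mult_radius(1)[of r2] llog_mult_radius(2)[of r1] 3 N_nonneg by (intro mult_left_mono) auto
    finally have 1: "norm (centre x2 r2 - b) \<le> N * (5 + llog r2 - llog r1)" .
    have "norm (centre x1 r1 - b) \<le> N * (1 + llog (4 * radius r1) - llog (16 * radius r1))"
      using 3 radius_pos radius_le_16[of r1] unfolding b_def centre_def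
      by (simp, intro diff) (auto simp: ball_subset_ball_iff)
    also have "\<dots> \<le> N * 5"
      using llog_mult_radius[of r1] 3 N_nonneg by (intro mult_left_mono) auto
    finally have 2: "norm (centre x1 r1 - b) \<le> N * 5" .
    have "norm (centre x2 r2 - centre x1 r1) \<le> N * (5 + llog r2 - llog r1) + N * 5"
      using norm_triangle_ineq4[of "centre x2 r2 - b" "centre x1 r1 - b"] 1 2 by simp
    also have "\<dots> = N * (10 + (llog r2 - llog r1))" by (simp add: algebra_simps)
    also have "\<dots> \<le> N * (10 * (1 + llog r2 - llog r1))"
      using l N_nonneg by (intro mult_left_mono) auto
    finally show ?thesis .
  qed
qed

text \<open>Inserting both centres gives 82 = 36 + 36 + 10; the factors \<open>t\<close> and
  \<open>1 + \<kappa>\<close> can be added where absent because both are at least 1.\<close>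

lemma diff_comp:
  assumes r: "0 < r1" "r1 \<le> 1" "0 < r2" and sub: "ball x2 (2 * r2) \<subseteq> ball x1 r1"
  shows "norm (Avg (ball x2 r2) (f \<circ> \<psi>) - Avg (ball x1 r1) (f \<circ> \<psi>))
    \<le> 82 * (1 + \<kappa>) * N * (1 + llog r2 - llog r1)"
proof -
  have l: "0 \<le> llog r2 - llog r1"
    using llog_antimono[of r2 r1] double_ball_subsetD(1)[OF r(3) sub] r by simp
  define t where "t = 1 + llog r2 - llog r1"
  have t: "1 \<le> t" using l by (simp add: t_def)
  let ?a2 = "Avg (ball x2 r2) (f \<circ> \<psi>) - centre x2 r2" and ?a1 = "Avg (ball x1 r1) (f \<circ> \<psi>) - centre x1 r1"
  have "norm (Avg (ball x2 r2) (f \<circ> \<psi>) - Avg (ball x1 r1) (f \<circ> \<psi>))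
    = norm ((?a2 - ?a1) + (centre x2 r2 - centre x1 r1))" by simp
  also have "\<dots> \<le> norm ?a2 + norm ?a1 + norm (centre x2 r2 - centre x1 r1)"
    by (intro norm_triangle_le add_mono norm_triangle_ineq4 order_refl)
  also have "\<dots> \<le> 36 * (1 + \<kappa>) * N + 36 * (1 + \<kappa>) * N + N * (10 * t)"
    unfolding t_def by (intro add_mono norm_Avg_comp_diff_centre norm_centre_diff assms)
  also have "\<dots> = (72 * (1 + \<kappa>) * N) * 1 + 10 * N * 1 * t" by simp
  also have "\<dots> \<le> (72 * (1 + \<kappa>) * N) * t + 10 * N * (1 + \<kappa>) * t"
    using t \<kappa> N_nonneg by (intro add_mono mult_left_mono mult_right_mono) auto
  also have "\<dots> = 82 * (1 + \<kappa>) * N * t" by (simp add: algebra_simps)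
  finally show ?thesis by (simp only: t_def)
qed

end

section \<open>From norms to explicit bounds and back; the final estimate\<close>

lemma LBMO_normD:
  assumes "LBMO_norm f \<le> ennreal N" "0 \<le> N"
  shows "0 < r \<Longrightarrow> Avg (ball x r) (\<lambda>y. norm (f y - Avg (ball x r) f)) \<le> N"
    and "0 < r1 \<Longrightarrow> r1 \<le> 1 \<Longrightarrow> 0 < r2 \<Longrightarrow> ball x2 (2 * r2) \<subseteq> ball x1 r1 \<Longrightarrow>
      norm (Avg (ball x2 r2) f - Avg (ball x1 r1) f) \<le> N * (1 + llog r2 - llog r1)"
proof -
  define S where "S = (SUP (x1, r1, x2, r2) \<in> {(x1, r1, x2, r2).
          0 < r1 \<and> r1 \<le> 1 \<and> 0 < r2 \<and> ball x2 (2 * r2) \<subseteq> ball x1 r1}.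
        ennreal (norm (Avg (ball x2 r2) f - Avg (ball x1 r1) f)
                 / (1 + ln ((1 - ln r2) / (1 - ln r1)))))"
  have le: "BMO_norm f + S \<le> ennreal N" using assms by (simp add: LBMO_norm_def S_def)
  have B: "BMO_norm f \<le> ennreal N" and S: "S \<le> ennreal N"
    using order_trans[OF _ le] by (simp_all add: add_increasing add_increasing2)
  { assume "0 < r"
    then have "ennreal (Avg (ball x r) (\<lambda>y. norm (f y - Avg (ball x r) f))) \<le> BMO_norm f"
      unfolding BMO_norm_def by (intro SUP_upper2[of "(x, r)"]) auto
    with B have "ennreal (Avg (ball x r) (\<lambda>y. norm (f y - Avg (ball x r) f))) \<le> ennreal N"
      by (rule order_trans[rotated])
    then show "Avg (ball x r) (\<lambda>y. norm (f y - Avg (ball x r) f)) \<le> N"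
      using assms by simp }
  { assume r: "0 < r1" "r1 \<le> 1" "0 < r2" and sub: "ball x2 (2 * r2) \<subseteq> ball x1 r1"
    note r12 = double_ball_subsetD(1)[OF r(3) sub]
    have l: "0 \<le> llog r2 - llog r1" using llog_antimono[of r2 r1] r r12 by simp
    have "ennreal (norm (Avg (ball x2 r2) f - Avg (ball x1 r1) f) / (1 + ln ((1 - ln r2) / (1 - ln r1)))) \<le> S"
      unfolding S_def using r sub by (intro SUP_upper2[of "(x1, r1, x2, r2)"]) auto
    with S have "ennreal (norm (Avg (ball x2 r2) f - Avg (ball x1 r1) f) / (1 + ln ((1 - ln r2) / (1 - ln r1)))) \<le> ennreal N"
      by (rule order_trans[rotated])
    then have "norm (Avg (ball x2 r2) f - Avg (ball x1 r1) f) / (1 + (llog r2 - llog r1)) \<le> N"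
      using assms r r12 by (simp add: llog_diff)
    then show "norm (Avg (ball x2 r2) f - Avg (ball x1 r1) f) \<le> N * (1 + llog r2 - llog r1)"
      using l by (simp add: pos_divide_le_eq algebra_simps) }
qed

lemma LBMO_normI:
  assumes "0 \<le> a" "0 \<le> b"
    and osc: "\<And>x r. 0 < r \<Longrightarrow> Avg (ball x r) (\<lambda>y. norm (f y - Avg (ball x r) f)) \<le> a"
    and diff: "\<And>x1 r1 x2 r2. 0 < r1 \<Longrightarrow> r1 \<le> 1 \<Longrightarrow> 0 < r2 \<Longrightarrow> ball x2 (2 * r2) \<subseteq> ball x1 r1 \<Longrightarrow>
      norm (Avg (ball x2 r2) f - Avg (ball x1 r1) f) \<le> b * (1 + llog r2 - llog r1)"
  shows "LBMO_norm f \<le> ennreal (a + b)"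
proof -
  have "norm (Avg (ball x2 r2) f - Avg (ball x1 r1) f) / (1 + ln ((1 - ln r2) / (1 - ln r1))) \<le> b"
    if r: "0 < r1" "r1 \<le> 1" "0 < r2" and sub: "ball x2 (2 * r2) \<subseteq> ball x1 r1" for x1 r1 x2 r2
  proof -
    note r12 = double_ball_subsetD(1)[OF r(3) sub]
    have l: "0 \<le> llog r2 - llog r1" using llog_antimono[of r2 r1] r r12 by simp
    show ?thesis
      using diff[OF r sub] r r12 l by (simp add: llog_diff pos_divide_le_eq algebra_simps)
  qed
  then show ?thesis
    unfolding LBMO_norm_def BMO_norm_def ennreal_plus[OF assms(1,2)]
    by (intro add_mono SUP_least) (auto intro!: ennreal_leI osc)
qed

lemma star_normD:
  assumes "star_norm \<psi> < \<infinity>"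
  shows "x \<noteq> y \<Longrightarrow> Phi (dist (\<psi> x) (\<psi> y)) (dist x y) \<le> enn2real (star_norm \<psi>)"
proof -
  assume "x \<noteq> y"
  then have "ennreal (Phi (dist (\<psi> x) (\<psi> y)) (dist x y)) \<le> star_norm \<psi>"
    unfolding star_norm_def by (intro SUP_upper2[of "(x, y)"]) auto
  also have "\<dots> = ennreal (enn2real (star_norm \<psi>))"
    using assms by simp
  finally show ?thesis by (subst (asm) ennreal_le_iff) auto
qed

theorem theorem2:
  shows "\<exists>C::real. C > 0 \<and>
    (\<forall>p::real. 1 < p \<and> p < 2 \<longrightarrow>
      (\<forall>f \<in> LBMO \<inter> Lp p. \<forall>\<psi>.
        measure_preserving_homeomorphism \<psi> \<and> star_norm \<psi> < \<infinity> \<longrightarrow>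
          f \<circ> \<psi> \<in> LBMO \<inter> Lp p \<and>
          LBMO_Lp_norm p (f \<circ> \<psi>)
            \<le> ennreal (C * ln (1 + enn2real (star_norm \<psi>))) * LBMO_Lp_norm p f))"
proof (intro exI[of _ 465] conjI allI impI ballI)
  fix p f \<psi>
  assume p: "1 < p \<and> p < (2::real)" and f: "f \<in> LBMO \<inter> Lp p"
    and "measure_preserving_homeomorphism \<psi> \<and> star_norm \<psi> < \<infinity>"
  then have mph: "measure_preserving_homeomorphism \<psi>" and fin: "star_norm \<psi> < \<infinity>" by auto
  define K where "K = enn2real (star_norm \<psi>)"
  \<comment> \<open>\<open>enn2real\<close> sends infinity to 0, so membership of \<open>f\<close>
    in \<open>LBMO\<close> is what makes \<open>N\<close> represent the full norm.\<close>
  define N where "N = Lp_norm p f + enn2real (LBMO_norm f)"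
  have K: "Phi (dist (\<psi> x) (\<psi> y)) (dist x y) \<le> K" if "x \<noteq> y" for x y
    using star_normD[OF fin that] by (simp add: K_def)
  have K1: "1 \<le> K"
  proof -
    \<comment> \<open>One pair of distinct points is needed for the lower bound of
      \<open>Phi\<close> to reach \<open>K\<close>; it makes \<open>ln K\<close>
      nonnegative.\<close>
    have "axis 1 1 \<noteq> (0 :: real^2)" by (simp add: axis_eq_0_iff)
    from order_trans[OF Phi_ge_1 K[OF this]] show ?thesis .
  qed
  have Lf: "LBMO_norm f = ennreal (enn2real (LBMO_norm f))"
    using f by (auto simp: LBMO_def)
  have Lp0: "0 \<le> Lp_norm p f" by (simp add: Lp_norm_def)
  then have N0: "0 \<le> N" by (simp add: N_def)
  have "LBMO_norm f \<le> ennreal N"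
    using Lf Lp0 by (metis N_def ennreal_leI le_add_same_cancel2)
  note D = LBMO_normD[OF this N0]
  have N_eq: "LBMO_Lp_norm p f = ennreal N"
    using Lf Lp0 by (simp add: LBMO_Lp_norm_def N_def)
  have inj: "\<psi> x \<noteq> \<psi> y" if "x \<noteq> y" for x y
    using that by (simp add: measure_preserving_homeomorphism_inject[OF mph])
  interpret lbmo_composition f N \<psi> "ln K"
  proof
    show "f \<in> borel_measurable lebesgue" "locally_integrable f"
      using f by (auto simp: Lp_def LBMO_def)
    show "norm (Avg (ball x r) f) \<le> 3 * N" if "1 / 2 \<le> r" for x r
    proof -
      have "norm (Avg (ball x r) f) \<le> 3 * Lp_norm p f"
        using f p that by (intro norm_Avg_le_Lp_norm) (auto simp: LBMO_def)
      also have "\<dots> \<le> 3 * N" by (simp add: N_def)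
      finally show ?thesis .
    qed
    show "llog (dist (\<psi> x) (\<psi> y)) \<le> llog (dist x y) + ln K" if "x \<noteq> y" for x y
      using that inj[OF that] by (intro llog_le_of_Phi_le K) auto
    show "llog (dist x y) \<le> llog (dist (\<psi> x) (\<psi> y)) + ln K" if "x \<noteq> y" for x y
      using that inj[OF that] K[OF that] by (intro llog_le_of_Phi_le) (auto simp: Phi_commute)
  qed (use D K1 mph in auto)
  have L: "LBMO_norm (f \<circ> \<psi>) \<le> ennreal (72 * (1 + ln K) * N + 82 * (1 + ln K) * N)"
    using N0 \<kappa> by (intro LBMO_normI osc_comp diff_comp) auto
  show "f \<circ> \<psi> \<in> LBMO \<inter> Lp p"
    using Lp_comp[OF mph] f loc_comp le_less_trans[OF L ennreal_less_top] by (auto simp: LBMO_def)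
  have "LBMO_Lp_norm p (f \<circ> \<psi>) \<le> ennreal N + ennreal (72 * (1 + ln K) * N + 82 * (1 + ln K) * N)"
    unfolding LBMO_Lp_norm_def using Lp_comp[OF mph] f
    by (intro add_mono L ennreal_leI) (auto simp: N_def)
  also have "\<dots> = ennreal (N + (72 * (1 + ln K) * N + 82 * (1 + ln K) * N))"
    using N0 \<kappa> by (intro ennreal_plus[symmetric]) auto
  also have "\<dots> \<le> ennreal (465 * ln (1 + K) * N)"
  proof (rule ennreal_leI)
    \<comment> \<open>The bound \<open>1 \<le> 2 * ln (1 + K)\<close> absorbs the additive 1, so
      \<open>1 + ln K \<le> 3 * ln (1 + K)\<close>. With 155 = 1 + 72 + 82 this gives 465 = 3 *
      155.\<close>
    have "1 / 2 \<le> ln (2::real)" using ln2_ge_two_thirds by simp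
    also have "\<dots> \<le> ln (1 + K)" using K1 by (intro ln_mono) auto
    finally have "1 / 2 \<le> ln (1 + K)" .
    moreover have "ln K \<le> ln (1 + K)" using K1 by (intro ln_mono) auto
    ultimately have "1 + ln K \<le> 3 * ln (1 + K)" by linarith
    moreover have "N + (72 * (1 + ln K) * N + 82 * (1 + ln K) * N) \<le> 155 * (1 + ln K) * N"
      using mult_nonneg_nonneg[OF \<kappa> N0] by (simp add: algebra_simps)
    moreover have "155 * (1 + ln K) * N \<le> 155 * (3 * ln (1 + K)) * N"
      using calculation(1) N0 by (intro mult_right_mono) auto
    ultimately show "N + (72 * (1 + ln K) * N + 82 * (1 + ln K) * N) \<le> 465 * ln (1 + K) * N"
      by simp
  qed
  also have "\<dots> = ennreal (465 * ln (1 + K)) * ennreal N"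
    using K1 N0 by (intro ennreal_mult) auto
  finally show "LBMO_Lp_norm p (f \<circ> \<psi>) \<le> ennreal (465 * ln (1 + enn2real (star_norm \<psi>))) * LBMO_Lp_norm p f"
    by (simp add: N_eq K_def)
qed simp

end
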